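(* Let $\Omega',\Omega\subset\mathbb{C}^2$ be smoothly bounded domains such that $\Omega'$ and $\Omega$ are pseudoconvex near $p_0'\in b\Omega'$ and $p_0\in b\Omega$, respectively. Let $\Phi\colon U'\to U$ be a biholomorphic map from an open neighborhood $U'\subset\mathbb{C}^2$ of $p_0'$ to an open neighborhood $U\subset\mathbb{C}^2$ of $p_0$ such that $\Phi(\Omega'\cap U')=\Omega\cap U$ and $\Phi(p_0')=p_0$. Then $p_0'$ is of strict type $4$ for $\Omega'$ if and only if $p_0$ is of strict type $4$ for $\Omega$.
   Context: "Smooth" means $\mathcal{C}^\infty$; "smoothly bounded" means that the boundary is smooth. A smooth function $r\colon U\to\mathbb{R}$ is a local defining function for $\Omega$ near $p_0\in b\Omega$ if $U$ is an open neighborhood of $p_0$, $\Omega\cap U=\{r<0\}$, and $dr\ne0$ on $b\Omega\cap U$. A "holomorphic vector field" means a smooth vector field of type $(1,0)$; it is tangential if $Lr=0$ on $b\Omega$. For $(1,0)$ vector fields, $H_f(A,B)=\sum_{j,k}\frac{\partial^2f}{\partial z^j\partial\bar z^k}A^j\overline{B^k}$. $\Omega$ is pseudoconvex at $p\in b\Omega$ if $H_r(L,L)\ge0$ on $b\Omega$ near $p$ for all holomorphic tangential $L$; strictly pseudoconvex at $p$ if in addition the inequality is strict whenever $L$ is nonvanishing; weakly pseudoconvex at $p$ if pseudoconvex but not strictly pseudoconvex at $p$. Strict type $4$: for a smooth local defining function $r$ near $p_0$ and a nonvanishing holomorphic tangential vector field $L$ near $p_0$, set $\lambda:=H_r(L,L)|_{b\Omega}$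 near $p_0$. $\Omega$ is of strict type $4$ at $p_0$ (equivalently, $p_0$ is of strict type 4 for $\Omega$) if $\Omega$ is weakly pseudoconvex at $p_0$ and $(L\bar L\lambda)(p_0)>|(LL\lambda)(p_0)|$. This does not depend on the choices of $r$ and $L$. *)

theory Defs
  imports "HOL-Analysis.Analysis"
begin

type_synonym C2 = "complex ^ 2"

fun times_cont_diff_on ::
  "nat \<Rightarrow> ('a::euclidean_space \<Rightarrow> 'b::real_normed_vector) \<Rightarrow> 'a set \<Rightarrow> bool" where
  "times_cont_diff_on 0 f U \<longleftrightarrow> continuous_on U f"
| "times_cont_diff_on (Suc k) f U \<longleftrightarrow>
     (\<forall>x\<in>U. f differentiable (at x)) \<and>
     (\<forall>v. times_cont_diff_on k (\<lambda>x. frechet_derivative f (at x) v) U)"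

text \<open>Intended for open \<open>U\<close> only: the derivatives are taken with respect to the full filter
  \<open>at x\<close>. Smoothness is in the real sense, also for maps on \<open>C2\<close>.\<close>

definition smooth_on ::
  "('a::euclidean_space \<Rightarrow> 'b::real_normed_vector) \<Rightarrow> 'a set \<Rightarrow> bool" where
  "smooth_on f U \<longleftrightarrow> (\<forall>k. times_cont_diff_on k f U)"

text \<open>Wirtinger derivatives, with \<open>z\<^sup>j = x\<^sup>j + \<i> y\<^sup>j\<close>: \<open>axis j 1\<close> and \<open>axis j \<i>\<close> are the real
  coordinate directions of \<open>x\<^sup>j\<close> and \<open>y\<^sup>j\<close>.\<close>

definition d_z :: "2 \<Rightarrow> (C2 \<Rightarrow> complex) \<Rightarrow> C2 \<Rightarrow> complex" where
  "d_z j f p = (frechet_derivative f (at p) (axis j 1)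
                - \<i> * frechet_derivative f (at p) (axis j \<i>)) / 2"

definition d_zbar :: "2 \<Rightarrow> (C2 \<Rightarrow> complex) \<Rightarrow> C2 \<Rightarrow> complex" where
  "d_zbar j f p = (frechet_derivative f (at p) (axis j 1)
                   + \<i> * frechet_derivative f (at p) (axis j \<i>)) / 2"

text \<open>A vector field \<open>L = (\<Sum>j. L\<^sup>j \<partial>/\<partial>z\<^sup>j)\<close> of type \<open>(1,0)\<close> is represented by its coefficient
  map \<open>p \<mapsto> (L\<^sup>1 p, L\<^sup>2 p)\<close>. The next two operators are \<open>f \<mapsto> L f\<close> and, for the conjugate field,
  \<open>f \<mapsto> Lbar f\<close>.\<close>

definition vf_apply :: "(C2 \<Rightarrow> C2) \<Rightarrow> (C2 \<Rightarrow> complex) \<Rightarrow> C2 \<Rightarrow> complex" where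
  "vf_apply L f p = (\<Sum>j\<in>UNIV. L p $ j * d_z j f p)"

definition vf_apply_bar :: "(C2 \<Rightarrow> C2) \<Rightarrow> (C2 \<Rightarrow> complex) \<Rightarrow> C2 \<Rightarrow> complex" where
  "vf_apply_bar L f p = (\<Sum>j\<in>UNIV. cnj (L p $ j) * d_zbar j f p)"

definition complex_hessian ::
  "(C2 \<Rightarrow> complex) \<Rightarrow> (C2 \<Rightarrow> C2) \<Rightarrow> (C2 \<Rightarrow> C2) \<Rightarrow> C2 \<Rightarrow> complex" where
  "complex_hessian f A B p =
     (\<Sum>j\<in>UNIV. \<Sum>k\<in>UNIV. d_z j (d_zbar k f) p * A p $ j * cnj (B p $ k))"

abbreviation cplx :: "(C2 \<Rightarrow> real) \<Rightarrow> C2 \<Rightarrow> complex" where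
  "cplx r \<equiv> (\<lambda>p. complex_of_real (r p))"

definition local_defining_function :: "C2 set \<Rightarrow> C2 \<Rightarrow> C2 set \<Rightarrow> (C2 \<Rightarrow> real) \<Rightarrow> bool" where
  "local_defining_function \<Omega> p U r \<longleftrightarrow>
     open U \<and> p \<in> U \<and> smooth_on r U \<and>
     \<Omega> \<inter> U = {q \<in> U. r q < 0} \<and>
     (\<forall>q \<in> frontier \<Omega> \<inter> U. \<exists>v. frechet_derivative r (at q) v \<noteq> 0)"

text \<open>``Smoothly bounded'' only refers to smoothness of the boundary; the domain itself need not
  be bounded.\<close>

definition smoothly_bounded_domain :: "C2 set \<Rightarrow> bool" where
  "smoothly_bounded_domain \<Omega> \<longleftrightarrow>
     open \<Omega> \<and> connected \<Omega> \<and> \<Omega> \<noteq> {} \<and>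
     (\<forall>p \<in> frontier \<Omega>. \<exists>U r. local_defining_function \<Omega> p U r)"

text \<open>\<open>L\<close> is a holomorphic tangential vector field on the neighbourhood \<open>V\<close> of \<open>p\<close>. Following
  the usual terminology, ``holomorphic'' means smooth of type \<open>(1,0)\<close>: the coefficients are
  smooth, not necessarily holomorphic, functions.\<close>

definition tangential_vf :: "C2 set \<Rightarrow> C2 \<Rightarrow> C2 set \<Rightarrow> (C2 \<Rightarrow> real) \<Rightarrow> (C2 \<Rightarrow> C2) \<Rightarrow> bool" where
  "tangential_vf \<Omega> p V r L \<longleftrightarrow>
     open V \<and> p \<in> V \<and> smooth_on L V \<and>
     (\<forall>q \<in> frontier \<Omega> \<inter> V. vf_apply L (cplx r) q = 0)"

text \<open>For real-valued smooth \<open>r\<close> the complex number \<open>complex_hessian (cplx r) L L q\<close> is real, so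
  that inequalities for it may be stated for its real part. The conditions below do not depend
  on the choice of the local defining function.\<close>

definition levi_nonneg :: "C2 set \<Rightarrow> C2 \<Rightarrow> C2 set \<Rightarrow> (C2 \<Rightarrow> real) \<Rightarrow> bool" where
  "levi_nonneg \<Omega> p U r \<longleftrightarrow>
     (\<forall>V L. V \<subseteq> U \<and> tangential_vf \<Omega> p V r L \<longrightarrow>
        (\<forall>\<^sub>F q in nhds p. q \<in> frontier \<Omega> \<longrightarrow> Re (complex_hessian (cplx r) L L q) \<ge> 0))"

definition levi_pos :: "C2 set \<Rightarrow> C2 \<Rightarrow> C2 set \<Rightarrow> (C2 \<Rightarrow> real) \<Rightarrow> bool" where
  "levi_pos \<Omega> p U r \<longleftrightarrow>
     (\<forall>V L. V \<subseteq> U \<and> tangential_vf \<Omega> p V r L \<and> (\<forall>q\<in>V. L q \<noteq> 0) \<longrightarrow>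
        (\<forall>\<^sub>F q in nhds p. q \<in> frontier \<Omega> \<longrightarrow> Re (complex_hessian (cplx r) L L q) > 0))"

definition pseudoconvex_at :: "C2 set \<Rightarrow> C2 \<Rightarrow> bool" where
  "pseudoconvex_at \<Omega> p \<longleftrightarrow>
     p \<in> frontier \<Omega> \<and> (\<exists>U r. local_defining_function \<Omega> p U r \<and> levi_nonneg \<Omega> p U r)"

definition strictly_pseudoconvex_at :: "C2 set \<Rightarrow> C2 \<Rightarrow> bool" where
  "strictly_pseudoconvex_at \<Omega> p \<longleftrightarrow>
     p \<in> frontier \<Omega> \<and>
     (\<exists>U r. local_defining_function \<Omega> p U r \<and> levi_nonneg \<Omega> p U r \<and> levi_pos \<Omega> p U r)"

definition weakly_pseudoconvex_at :: "C2 set \<Rightarrow> C2 \<Rightarrow> bool" where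
  "weakly_pseudoconvex_at \<Omega> p \<longleftrightarrow> pseudoconvex_at \<Omega> p \<and> \<not> strictly_pseudoconvex_at \<Omega> p"

definition pseudoconvex_near :: "C2 set \<Rightarrow> C2 \<Rightarrow> bool" where
  "pseudoconvex_near \<Omega> p \<longleftrightarrow> (\<forall>\<^sub>F q in nhds p. q \<in> frontier \<Omega> \<longrightarrow> pseudoconvex_at \<Omega> q)"

text \<open>The function \<open>\<lambda>\<close> of the definition is the restriction of \<open>complex_hessian (cplx r) L L\<close> to
  the boundary. As \<open>L\<close> and its conjugate are tangential, their derivatives of a function on the
  boundary are computed from an arbitrary smooth extension; here the extension is
  \<open>complex_hessian (cplx r) L L\<close> itself. At a weakly pseudoconvex point \<open>p\<close> the function \<open>\<lambda>\<close>
  attains the minimal value \<open>0\<close> along the boundary, so its first derivatives along the boundary,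
  in particular the commutator of \<open>L\<close> and its conjugate applied to \<open>\<lambda>\<close>, vanish at \<open>p\<close>; hence the
  left-hand side of the last inequality is the real part of a real number. The inequality does
  not depend on the choice of \<open>r\<close> and \<open>L\<close>.\<close>

definition strict_type_4 :: "C2 set \<Rightarrow> C2 \<Rightarrow> bool" where
  "strict_type_4 \<Omega> p \<longleftrightarrow>
     weakly_pseudoconvex_at \<Omega> p \<and>
     (\<exists>U r L. local_defining_function \<Omega> p U r \<and> tangential_vf \<Omega> p U r L \<and> (\<forall>q\<in>U. L q \<noteq> 0) \<and>
        (let lam = complex_hessian (cplx r) L L
         in Re (vf_apply L (vf_apply_bar L lam) p) > cmod (vf_apply L (vf_apply L lam) p)))"

definition holomorphic_map_on :: "(C2 \<Rightarrow> C2) \<Rightarrow> C2 set \<Rightarrow> bool" where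
  "holomorphic_map_on F U \<longleftrightarrow>
     (\<forall>p\<in>U. \<exists>D. (F has_derivative D) (at p) \<and> (\<forall>c v. D (c *s v) = c *s D v))"

definition biholomorphic_map :: "(C2 \<Rightarrow> C2) \<Rightarrow> C2 set \<Rightarrow> C2 set \<Rightarrow> bool" where
  "biholomorphic_map F U' U \<longleftrightarrow>
     open U' \<and> open U \<and> bij_betw F U' U \<and>
     holomorphic_map_on F U' \<and> holomorphic_map_on (inv_into U' F) U"

end

theory Submission
  imports Defs "HOL-Complex_Analysis.Cauchy_Integral_Formula"
begin

text \<open>
  A local defining function \<open>r\<close> and a tangential \<open>(1,0)\<close> field \<open>L\<close> for \<open>\<Omega>\<close> near \<open>p0\<close> pull back to
  \<open>r \<circ> \<Phi>\<close> and \<open>L' = d\<Phi>\<^sup>-\<^sup>1 (L \<circ> \<Phi>)\<close> for \<open>\<Omega>'\<close> near \<open>p0'\<close>. Since \<open>\<Phi>\<close> is holomorphic,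
  \<open>L' (f \<circ> \<Phi>) = (L f) \<circ> \<Phi>\<close>, likewise for the conjugate field, and the complex Hessian is invariant:
  hence \<open>\<lambda>' = \<lambda> \<circ> \<Phi>\<close> near \<open>p0'\<close>, and both second-order expressions in the strict type 4
  inequality agree at \<open>p0'\<close> and \<open>p0\<close>. Fields on the \<open>\<Omega>'\<close> side are likewise pushed forward, so Levi
  positivity is preserved too; the converse direction is the same argument for \<open>\<Phi>\<^sup>-\<^sup>1\<close>. That
  \<open>\<Phi>\<close>, merely complex differentiable by definition, is smooth follows by differentiating the
  one-variable Cauchy integral along complex lines with respect to the base point.
\<close>

section \<open>Calculus of smooth functions\<close>

lemma has_derivative_frechet_derivative:
  "f differentiable (at x) \<Longrightarrow> (f has_derivative (\<lambda>v. frechet_derivative f (at x) v)) (at x)"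
  using frechet_derivative_works by blast

lemma frechet_derivative_eqI:
  "(f has_derivative D) (at x) \<Longrightarrow> frechet_derivative f (at x) v = D v"
  using frechet_derivative_at by metis

text \<open>Openness is essential: the derivatives use the full filter \<open>at x\<close>, so
  agreement on \<open>U\<close> passes to derivatives only when \<open>U\<close> is a neighbourhood
  of each of its points.\<close>

lemma times_cont_diff_on_cong:
  assumes "open U" "\<And>x. x \<in> U \<Longrightarrow> f x = g x" "times_cont_diff_on k f U"
  shows "times_cont_diff_on k g U"
  using assms(2,3)
proof (induction k arbitrary: f g)
  case 0
  then show ?case by (auto cong: continuous_on_cong)
next
  case (Suc k)
  have D: "(g has_derivative (\<lambda>v. frechet_derivative f (at x) v)) (at x)" if "x \<in> U" for x
    using has_derivative_transform_within_open[OF has_derivative_frechet_derivative assms(1) that]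
      Suc.prems that by auto
  show ?case
    unfolding times_cont_diff_on.simps
  proof (intro conjI ballI allI)
    fix x assume "x \<in> U"
    then show "g differentiable (at x)" using D differentiable_def by blast
  next
    fix v
    show "times_cont_diff_on k (\<lambda>x. frechet_derivative g (at x) v) U"
      by (rule Suc.IH[of "\<lambda>x. frechet_derivative f (at x) v"])
        (use Suc.prems frechet_derivative_eqI[OF D] in auto)
  qed
qed

text \<open>The closure proofs below know the derivative through a formula such as the product or
  chain rule; this rule lets them work with that formula in place of
  \<open>frechet_derivative\<close>.\<close>

lemma times_cont_diff_on_SucI:
  assumes "open U" "\<And>x. x \<in> U \<Longrightarrow> (f has_derivative D x) (at x)"
    and "\<And>v. times_cont_diff_on k (\<lambda>x. D x v) U"
  shows "times_cont_diff_on (Suc k) f U"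
  unfolding times_cont_diff_on.simps
proof (intro conjI ballI allI)
  fix x assume "x \<in> U"
  then show "f differentiable (at x)" using assms(2) differentiable_def by blast
next
  fix v
  show "times_cont_diff_on k (\<lambda>x. frechet_derivative f (at x) v) U"
    by (rule times_cont_diff_on_cong[OF assms(1) _ assms(3)[of v]])
      (simp add: frechet_derivative_eqI[OF assms(2)])
qed

lemma times_cont_diff_on_Suc_imp:
  "times_cont_diff_on (Suc k) f U \<Longrightarrow> times_cont_diff_on k f U"
proof (induction k arbitrary: f)
  case 0
  then show ?case
    by (auto intro!: continuous_at_imp_continuous_on differentiable_imp_continuous_within)
next
  case (Suc k)
  then show ?case by (metis times_cont_diff_on.simps(2))
qed

lemma times_cont_diff_on_Suc_derivative:
  "times_cont_diff_on (Suc k) f U \<Longrightarrow> x \<in> U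
    \<Longrightarrow> (f has_derivative (\<lambda>v. frechet_derivative f (at x) v)) (at x)"
  by (auto intro: has_derivative_frechet_derivative)

lemma times_cont_diff_on_subset:
  "times_cont_diff_on k f U \<Longrightarrow> V \<subseteq> U \<Longrightarrow> times_cont_diff_on k f V"
  by (induction k arbitrary: f) (auto intro: continuous_on_subset)

lemma times_cont_diff_on_const:
  assumes "open U" shows "times_cont_diff_on k (\<lambda>x. c) U"
  by (induction k arbitrary: c) auto

lemma times_cont_diff_on_linear:
  assumes "open U" "bounded_linear h" "times_cont_diff_on k f U"
  shows "times_cont_diff_on k (\<lambda>x. h (f x)) U"
  using assms(3)
proof (induction k arbitrary: f)
  case 0
  then show ?case using bounded_linear.continuous_on[OF assms(2)] by simp
next
  case (Suc k)
  show ?case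
    by (rule times_cont_diff_on_SucI[OF assms(1)
          bounded_linear.has_derivative[OF assms(2) times_cont_diff_on_Suc_derivative[OF Suc.prems]]])
      (use Suc in auto)
qed

lemma times_cont_diff_on_add:
  assumes "open U" "times_cont_diff_on k f U" "times_cont_diff_on k g U"
  shows "times_cont_diff_on k (\<lambda>x. f x + g x) U"
  using assms(2,3)
proof (induction k arbitrary: f g)
  case 0
  then show ?case by (simp add: continuous_on_add)
next
  case (Suc k)
  show ?case
    by (rule times_cont_diff_on_SucI[OF assms(1) has_derivative_add])
      (use Suc in \<open>auto intro: has_derivative_frechet_derivative\<close>)
qed

lemma times_cont_diff_on_bilinear:
  assumes "open U" "bounded_bilinear h" "times_cont_diff_on k f U" "times_cont_diff_on k g U"
  shows "times_cont_diff_on k (\<lambda>x. h (f x) (g x)) U"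
  using assms(3,4)
proof (induction k arbitrary: f g)
  case 0
  then show ?case using bounded_bilinear.continuous_on[OF assms(2)] by simp
next
  case (Suc k)
  \<comment> \<open>Each term of the product rule pairs a derivative with an undifferentiated
    factor, whose order \<open>k\<close> comes from
    \<open>times_cont_diff_on_Suc_imp\<close>.\<close>
  show ?case
    by (rule times_cont_diff_on_SucI[OF assms(1) bounded_bilinear.FDERIV[OF assms(2)
            times_cont_diff_on_Suc_derivative[OF Suc.prems(1)]
            times_cont_diff_on_Suc_derivative[OF Suc.prems(2)]]])
      (use Suc times_cont_diff_on_Suc_imp[OF Suc.prems(1)]
         times_cont_diff_on_Suc_imp[OF Suc.prems(2)]
       in \<open>auto intro!: times_cont_diff_on_add[OF assms(1)]\<close>)
qed

lemma times_cont_diff_on_sum: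
  assumes "open U" "finite I" "\<And>i. i \<in> I \<Longrightarrow> times_cont_diff_on k (f i) U"
  shows "times_cont_diff_on k (\<lambda>x. \<Sum>i\<in>I. f i x) U"
  using assms(2,3)
  by (induction I)
    (auto intro: times_cont_diff_on_const[OF assms(1)] times_cont_diff_on_add[OF assms(1)])

text \<open>The definition of \<open>times_cont_diff_on\<close> controls derivatives in fixed
  directions only. In composites and pulled-back fields the direction varies with the point; the
  expansion moves this variation into scalar coefficients.\<close>

lemma frechet_derivative_basis_expansion:
  fixes f :: "'b::euclidean_space \<Rightarrow> 'c::real_normed_vector"
  assumes "f differentiable (at y)"
  shows "frechet_derivative f (at y) w = (\<Sum>b\<in>Basis. (w \<bullet> b) *\<^sub>R frechet_derivative f (at y) b)"
proof -
  have L: "linear (frechet_derivative f (at y))" using assms by (rule linear_frechet_derivative)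
  have "frechet_derivative f (at y) w = frechet_derivative f (at y) (\<Sum>b\<in>Basis. (w \<bullet> b) *\<^sub>R b)"
    by (simp add: euclidean_representation)
  also have "\<dots> = (\<Sum>b\<in>Basis. (w \<bullet> b) *\<^sub>R frechet_derivative f (at y) b)"
    by (simp add: linear_sum[OF L] linear_scale[OF L])
  finally show ?thesis .
qed

lemma times_cont_diff_on_compose:
  fixes f :: "'b::euclidean_space \<Rightarrow> 'c::real_normed_vector" and g :: "'a::euclidean_space \<Rightarrow> 'b"
  assumes "open U" "times_cont_diff_on k f V" "times_cont_diff_on k g U" "g ` U \<subseteq> V"
  shows "times_cont_diff_on k (\<lambda>x. f (g x)) U"
  using assms(2,3)
proof (induction k arbitrary: f)
  case 0
  then show ?case using assms(4) by (auto intro: continuous_on_compose2)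
next
  case (Suc k)
  let ?D = "\<lambda>x v. frechet_derivative f (at (g x)) (frechet_derivative g (at x) v)"
  have fd: "f differentiable (at (g x))" if "x \<in> U" for x
    using Suc.prems(1) assms(4) that by auto
  have gd: "g differentiable (at x)" if "x \<in> U" for x
    using Suc.prems(2) that by auto
  show ?case
  proof (rule times_cont_diff_on_SucI[where D = ?D])
    show "open U" by fact
    show "((\<lambda>x. f (g x)) has_derivative ?D x) (at x)" if "x \<in> U" for x
      using diff_chain_at[OF has_derivative_frechet_derivative[OF gd[OF that]]
          has_derivative_frechet_derivative[OF fd[OF that]]] by (simp add: o_def)
    fix v
    have "times_cont_diff_on k
        (\<lambda>x. \<Sum>b\<in>Basis. (frechet_derivative g (at x) v \<bullet> b) *\<^sub>R frechet_derivative f (at (g x)) b) U"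
    proof (intro times_cont_diff_on_sum times_cont_diff_on_bilinear[OF _ bounded_bilinear_scaleR])
      fix b :: 'b assume "b \<in> Basis"
      show "times_cont_diff_on k (\<lambda>x. frechet_derivative g (at x) v \<bullet> b) U"
        by (rule times_cont_diff_on_linear[OF assms(1) bounded_linear_inner_left])
          (use Suc.prems in auto)
      show "times_cont_diff_on k (\<lambda>x. frechet_derivative f (at (g x)) b) U"
        by (rule Suc.IH) (use Suc.prems times_cont_diff_on_Suc_imp[OF Suc.prems(2)] in auto)
    qed (use assms(1) in auto)
    then show "times_cont_diff_on k (\<lambda>x. ?D x v) U"
      by (rule times_cont_diff_on_cong[OF assms(1), rotated])
        (rule frechet_derivative_basis_expansion[symmetric, OF fd])
  qed
qed

section \<open>Closure properties of \<open>smooth_on\<close>\<close>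

lemma smooth_on_cong:
  "open U \<Longrightarrow> (\<And>x. x \<in> U \<Longrightarrow> f x = g x) \<Longrightarrow> smooth_on f U \<Longrightarrow> smooth_on g U"
  unfolding smooth_on_def using times_cont_diff_on_cong by metis

lemma smooth_on_subset: "smooth_on f U \<Longrightarrow> V \<subseteq> U \<Longrightarrow> smooth_on f V"
  unfolding smooth_on_def using times_cont_diff_on_subset by blast

lemma smooth_on_linear:
  "open U \<Longrightarrow> bounded_linear h \<Longrightarrow> smooth_on f U \<Longrightarrow> smooth_on (\<lambda>x. h (f x)) U"
  unfolding smooth_on_def using times_cont_diff_on_linear by blast

lemma smooth_on_add:
  "open U \<Longrightarrow> smooth_on f U \<Longrightarrow> smooth_on g U \<Longrightarrow> smooth_on (\<lambda>x. f x + g x) U"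
  unfolding smooth_on_def using times_cont_diff_on_add by blast

lemma smooth_on_bilinear:
  "open U \<Longrightarrow> bounded_bilinear h \<Longrightarrow> smooth_on f U \<Longrightarrow> smooth_on g U
    \<Longrightarrow> smooth_on (\<lambda>x. h (f x) (g x)) U"
  unfolding smooth_on_def using times_cont_diff_on_bilinear by blast

lemma smooth_on_sum:
  "open U \<Longrightarrow> finite I \<Longrightarrow> (\<And>i. i \<in> I \<Longrightarrow> smooth_on (f i) U) \<Longrightarrow> smooth_on (\<lambda>x. \<Sum>i\<in>I. f i x) U"
  unfolding smooth_on_def using times_cont_diff_on_sum by blast

lemma smooth_on_compose:
  fixes f :: "'b::euclidean_space \<Rightarrow> 'c::real_normed_vector" and g :: "'a::euclidean_space \<Rightarrow> 'b"
  shows "open U \<Longrightarrow> smooth_on f V \<Longrightarrow> smooth_on g U \<Longrightarrow> g ` U \<subseteq> V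
    \<Longrightarrow> smooth_on (\<lambda>x. f (g x)) U"
  unfolding smooth_on_def using times_cont_diff_on_compose by blast

lemma smooth_on_frechet_derivative:
  "smooth_on f U \<Longrightarrow> smooth_on (\<lambda>x. frechet_derivative f (at x) v) U"
  unfolding smooth_on_def using times_cont_diff_on.simps(2) by blast

lemma smooth_on_differentiable: "smooth_on f U \<Longrightarrow> x \<in> U \<Longrightarrow> f differentiable (at x)"
  unfolding smooth_on_def using times_cont_diff_on.simps(2) by blast

section \<open>Holomorphic functions of several variables are smooth\<close>

text \<open>Scalar counterpart of \<open>holomorphic_map_on\<close>. The derivative is already real
  linear, so homogeneity over complex scalars makes it complex linear.\<close>

definition holomorphic_fun_on :: "(complex ^ 'n \<Rightarrow> complex) \<Rightarrow> (complex ^ 'n) set \<Rightarrow> bool" where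
  "holomorphic_fun_on g U \<longleftrightarrow>
     (\<forall>x\<in>U. \<exists>D. (g has_derivative D) (at x) \<and> (\<forall>c v. D (c *s v) = c * D v))"

lemma norm_vector_scalar_mult: "norm (c *s (v :: complex ^ 'n)) = cmod c * norm v"
  by (simp add: norm_vec_def norm_mult L2_set_right_distrib)

lemma bounded_bilinear_vector_scalar_mult:
  "bounded_bilinear (\<lambda>c (v :: complex ^ 'n). c *s v)"
proof
  show "\<exists>K. \<forall>a b. norm (a *s (b :: complex ^ 'n)) \<le> norm a * norm b * K"
    by (rule exI[of _ 1]) (simp add: norm_vector_scalar_mult)
qed (auto simp: vec_eq_iff algebra_simps)

lemma holomorphic_fun_onD:
  assumes "holomorphic_fun_on g U" "x \<in> U"
  shows "(g has_derivative (\<lambda>v. frechet_derivative g (at x) v)) (at x)"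
    and "frechet_derivative g (at x) (c *s v) = c * frechet_derivative g (at x) v"
proof -
  obtain D where D: "(g has_derivative D) (at x)" "\<And>c v. D (c *s v) = c * D v"
    using assms unfolding holomorphic_fun_on_def by blast
  have "D = frechet_derivative g (at x)" using D(1) frechet_derivative_at by blast
  with D show "(g has_derivative (\<lambda>v. frechet_derivative g (at x) v)) (at x)"
    and "frechet_derivative g (at x) (c *s v) = c * frechet_derivative g (at x) v" by auto
qed

lemma holomorphic_fun_on_continuous: "holomorphic_fun_on g U \<Longrightarrow> continuous_on U g"
  by (meson continuous_at_imp_continuous_on has_derivative_continuous holomorphic_fun_onD(1))

text \<open>The slice parameter \<open>w\<close> is integrated over a fixed circle, so the base point \<open>x\<close> enters the
  integrand only through \<open>g\<close>.\<close>

lemma directional_derivative_Cauchy_integral: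
  fixes g :: "complex ^ 'n \<Rightarrow> complex"
  assumes g: "holomorphic_fun_on g U" and "\<rho> > 0"
    and U: "\<And>w. cmod w \<le> \<rho> \<Longrightarrow> x + w *s v \<in> U"
  shows "frechet_derivative g (at x) v =
    integral {0..1} (\<lambda>t. g (x + circlepath 0 \<rho> t *s v) / circlepath 0 \<rho> t)"
proof -
  let ?h = "\<lambda>w. g (x + w *s v)"
  \<comment> \<open>Chain rule on the slice: homogeneity turns the derivative at
    \<open>c *s v\<close> into \<open>c\<close> times a fixed number, which is complex
    differentiability in one variable.\<close>
  have der: "(?h has_field_derivative frechet_derivative g (at (x + w *s v)) v) (at w)"
    if "cmod w \<le> \<rho>" for w
  proof -
    have "((\<lambda>w. x + w *s v) has_derivative (\<lambda>c. c *s v)) (at w)"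
      using bounded_linear.has_derivative[OF bounded_bilinear.bounded_linear_left
          [OF bounded_bilinear_vector_scalar_mult] has_derivative_ident]
      by (auto intro!: derivative_eq_intros)
    from diff_chain_at[OF this holomorphic_fun_onD(1)[OF g U[OF that]]]
    show ?thesis
      by (simp add: has_field_derivative_def o_def holomorphic_fun_onD(2)[OF g U[OF that]] mult_commute_abs)
  qed
  have cont: "continuous_on (cball 0 \<rho>) ?h"
    using der by (intro continuous_at_imp_continuous_on ballI) (auto intro: DERIV_isCont)
  have hol: "?h holomorphic_on ball 0 \<rho>"
    unfolding holomorphic_on_def
  proof
    fix w :: complex assume "w \<in> ball 0 \<rho>"
    then have "cmod w \<le> \<rho>" by simp
    from der[OF this] show "?h field_differentiable (at w within ball 0 \<rho>)"
      unfolding field_differentiable_def by (blast intro: has_field_derivative_at_within)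
  qed
  have nz: "circlepath 0 \<rho> t \<noteq> 0"
    and vd: "vector_derivative (circlepath 0 \<rho>) (at t) = 2 * pi * \<i> * circlepath 0 \<rho> t" for t
    using \<open>\<rho> > 0\<close> by (simp_all add: vector_derivative_circlepath) (simp_all add: circlepath mult_ac)
  have "2 * pi * \<i> * frechet_derivative g (at x) v = 2 * pi * \<i> * deriv ?h 0"
    using DERIV_imp_deriv[OF der[of 0]] \<open>\<rho> > 0\<close> by simp
  also have "\<dots> = contour_integral (circlepath 0 \<rho>) (\<lambda>u. ?h u / (u - 0)^2)"
    using Cauchy_contour_integral_circlepath_2[OF cont hol, of 0] \<open>\<rho> > 0\<close> by simp
  \<comment> \<open>The Cauchy kernel is \<open>1 / u^2\<close>, and the velocity of the circle is
    \<open>2 * pi * \<i>\<close> times its position; this cancels one power of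
    \<open>u\<close>.\<close>
  also have "\<dots> = integral {0..1} (\<lambda>t. 2 * pi * \<i> * (?h (circlepath 0 \<rho> t) / circlepath 0 \<rho> t))"
    unfolding contour_integral_integral
    by (rule integral_cong) (use nz in \<open>simp add: vd power2_eq_square\<close>)
  also have "\<dots> = 2 * pi * \<i> * integral {0..1} (\<lambda>t. ?h (circlepath 0 \<rho> t) / circlepath 0 \<rho> t)"
    by (rule integral_mult_right)
  finally show ?thesis by simp
qed

text \<open>A single radius serves all base points near \<open>x0\<close>, so that the integral
  formula holds on a neighbourhood and can be differentiated in the base point.\<close>

lemma uniform_slice_radius:
  fixes x0 v :: "complex ^ 'n"
  assumes "open U" "x0 \<in> U"
  obtains \<rho> where "\<rho> > 0" "\<And>x w. x \<in> ball x0 \<rho> \<Longrightarrow> cmod w \<le> \<rho> \<Longrightarrow> x + w *s v \<in> U"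
proof -
  obtain R where R: "R > 0" "ball x0 R \<subseteq> U" using assms openE by blast
  \<comment> \<open>The base point moves by less than \<open>\<rho>\<close> and the slice by at most
    \<open>\<rho> * norm v\<close>, together less than \<open>R / 2\<close>. The summand
    \<open>1\<close> keeps the denominator positive for \<open>v = 0\<close>.\<close>
  define \<rho> where "\<rho> = R / 2 / (1 + norm v)"
  have pos: "1 + norm v > 0" by (simp add: add_pos_nonneg)
  have \<rho>: "\<rho> > 0" using R pos by (simp add: \<rho>_def)
  have eq: "\<rho> * (1 + norm v) = R / 2"
    unfolding \<rho>_def by (rule nonzero_eq_divide_eq[THEN iffD1, OF _ refl]) (use pos in linarith)
  show ?thesis
  proof (rule that[OF \<rho>])
    fix x :: "complex ^ 'n" and w assume x: "x \<in> ball x0 \<rho>" and w: "cmod w \<le> \<rho>"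
    have "dist x0 (x + w *s v) \<le> dist x0 x + norm (w *s v)"
      by (metis add_diff_cancel_left' dist_norm dist_triangle norm_minus_commute)
    also have "\<dots> < \<rho> + \<rho> * norm v"
      using x w by (intro add_less_le_mono) (auto simp: norm_vector_scalar_mult mult_right_mono)
    also have "\<dots> < R" using eq R by (simp add: algebra_simps)
    finally show "x + w *s v \<in> U" using R by auto
  qed
qed

text \<open>Joint continuity in base point and angle, for a general \<open>h\<close> because it is
  applied both to \<open>g\<close> and to its directional derivatives.\<close>

lemma continuous_on_circle_slice:
  fixes h :: "complex ^ 'n \<Rightarrow> complex"
  assumes "continuous_on U h" "\<rho> > 0" "\<And>x w. x \<in> B \<Longrightarrow> cmod w \<le> \<rho> \<Longrightarrow> x + w *s v \<in> U"
  shows "continuous_on (B \<times> cbox 0 1) (\<lambda>(x, t). h (x + circlepath 0 \<rho> t *s v) / circlepath 0 \<rho> t)"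
proof -
  have c: "continuous_on (B \<times> cbox 0 1) (\<lambda>p. circlepath 0 \<rho> (snd p))"
    unfolding circlepath by (intro continuous_intros)
  have "continuous_on (B \<times> cbox 0 1) (\<lambda>p. fst p + circlepath 0 \<rho> (snd p) *s v)"
    by (intro continuous_on_add continuous_on_fst continuous_on_id
        bounded_bilinear.continuous_on[OF bounded_bilinear_vector_scalar_mult] c continuous_on_const)
  then have "continuous_on (B \<times> cbox 0 1) (\<lambda>p. h (fst p + circlepath 0 \<rho> (snd p) *s v))"
    by (rule continuous_on_compose2[OF assms(1)])
      (use assms(2,3) in \<open>auto simp: circlepath norm_mult\<close>)
  then show ?thesis
    unfolding split_beta
    by (intro continuous_on_divide c) (use assms(2) in \<open>auto simp: circlepath\<close>)
qed

text \<open>The integral formula depends continuously on the base point as soon as \<open>g\<close>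
  is continuous. This comes first because differentiation under the integral requires a continuous
  derivative of the integrand.\<close>

lemma holomorphic_fun_on_continuous_derivative:
  fixes g :: "complex ^ 'n \<Rightarrow> complex"
  assumes g: "holomorphic_fun_on g U" and "open U"
  shows "continuous_on U (\<lambda>x. frechet_derivative g (at x) v)"
proof (rule continuous_at_imp_continuous_on, rule ballI)
  fix x0 assume "x0 \<in> U"
  with \<open>open U\<close> obtain \<rho> where \<rho>: "\<rho> > 0" "\<And>x w. x \<in> ball x0 \<rho> \<Longrightarrow> cmod w \<le> \<rho> \<Longrightarrow> x + w *s v \<in> U"
    by (rule uniform_slice_radius[where v = v]) blast
  have "continuous_on (ball x0 \<rho>)
      (\<lambda>x. integral (cbox 0 1) (\<lambda>t. g (x + circlepath 0 \<rho> t *s v) / circlepath 0 \<rho> t))"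
    by (rule integral_continuous_on_param)
      (rule continuous_on_circle_slice[OF holomorphic_fun_on_continuous[OF g] \<rho>])
  then have "continuous_on (ball x0 \<rho>) (\<lambda>x. frechet_derivative g (at x) v)"
    by (rule continuous_on_eq) (use directional_derivative_Cauchy_integral[OF g \<rho>(1) \<rho>(2)] in auto)
  then show "isCont (\<lambda>x. frechet_derivative g (at x) v) x0"
    using \<rho>(1) by (simp add: continuous_on_eq_continuous_at)
qed

text \<open>Differentiating the Cauchy integral in the base point gives an integral of complex
  linear maps, which is again complex linear; so holomorphy reproduces itself.\<close>

lemma holomorphic_fun_on_derivative:
  fixes g :: "complex ^ 'n \<Rightarrow> complex"
  assumes g: "holomorphic_fun_on g U" and "open U"
  shows "holomorphic_fun_on (\<lambda>x. frechet_derivative g (at x) v) U"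
  unfolding holomorphic_fun_on_def
proof
  fix x0 assume x0: "x0 \<in> U"
  with \<open>open U\<close> obtain \<rho> where \<rho>: "\<rho> > 0" "\<And>x w. x \<in> ball x0 \<rho> \<Longrightarrow> cmod w \<le> \<rho> \<Longrightarrow> x + w *s v \<in> U"
    by (rule uniform_slice_radius[where v = v]) blast
  let ?c = "circlepath 0 \<rho>"
  have cU: "x + ?c t *s v \<in> U" if "x \<in> ball x0 \<rho>" for x t
    using that \<rho> by (auto simp: circlepath norm_mult)
  \<comment> \<open>The Leibniz rule takes the derivative of the integrand as a bounded linear map,
    hence the packaging by \<open>Blinfun\<close>.\<close>
  define F where "F x t = Blinfun (\<lambda>h. frechet_derivative g (at (x + ?c t *s v)) h / ?c t)" for x t
  have der: "((\<lambda>x. g (x + ?c t *s v) / ?c t) has_derivative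
      (\<lambda>h. frechet_derivative g (at (x + ?c t *s v)) h / ?c t)) (at x)"
    if "x \<in> ball x0 \<rho>" for x t
  proof -
    have "((\<lambda>x. x + ?c t *s v) has_derivative (\<lambda>h. h)) (at x)"
      by (auto intro!: derivative_eq_intros)
    from diff_chain_at[OF this holomorphic_fun_onD(1)[OF g cU[OF that]]]
    show ?thesis
      by (intro bounded_linear.has_derivative[OF bounded_linear_divide]) (simp add: o_def)
  qed
  have F: "blinfun_apply (F x t) = (\<lambda>h. frechet_derivative g (at (x + ?c t *s v)) h / ?c t)"
    if "x \<in> ball x0 \<rho>" for x t
    unfolding F_def by (rule bounded_linear_Blinfun_apply[OF has_derivative_bounded_linear[OF der[OF that]]])
  \<comment> \<open>In finite dimensions continuity of an operator-valued map can be tested on fixed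
    vectors, which reduces it to the continuity of directional derivatives.\<close>
  have contF: "continuous_on (ball x0 \<rho> \<times> cbox 0 1) (\<lambda>(x, t). F x t)"
  proof (rule continuous_on_blinfun_componentwise)
    fix i :: "complex ^ 'n"
    have "continuous_on (ball x0 \<rho> \<times> cbox 0 1)
        (\<lambda>(x, t). frechet_derivative g (at (x + ?c t *s v)) i / ?c t)"
      by (rule continuous_on_circle_slice[OF holomorphic_fun_on_continuous_derivative[OF assms] \<rho>])
    then show "continuous_on (ball x0 \<rho> \<times> cbox 0 1) (\<lambda>p. blinfun_apply (case p of (x, t) \<Rightarrow> F x t) i)"
      by (rule continuous_on_eq) (use F in auto)
  qed
  have cont_Pair: "continuous_on (cbox 0 (1::real)) (Pair x)" for x :: "complex ^ 'n"
    by (rule continuous_on_Pair[OF continuous_on_const continuous_on_id])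
  have intg: "(\<lambda>t. h (x + ?c t *s v) / ?c t) integrable_on cbox 0 1"
    if "x \<in> ball x0 \<rho>" "continuous_on U h" for x and h :: "complex ^ 'n \<Rightarrow> complex"
  proof (rule integrable_continuous)
    show "continuous_on (cbox 0 1) (\<lambda>t. h (x + ?c t *s v) / ?c t)"
      using continuous_on_compose2[OF continuous_on_circle_slice[where B = "ball x0 \<rho>", OF that(2) \<rho>]
          cont_Pair[of x]] that(1) by force
  qed
  let ?I = "\<lambda>x. integral (cbox 0 1) (\<lambda>t. g (x + ?c t *s v) / ?c t)"
  have "(?I has_derivative blinfun_apply (integral (cbox 0 1) (F x0))) (at x0 within ball x0 \<rho>)"
    by (rule leibniz_rule[OF _ intg[OF _ holomorphic_fun_on_continuous[OF g]] contF])
      (use \<rho>(1) der F in \<open>auto intro: has_derivative_at_withinI\<close>)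
  then have "(?I has_derivative blinfun_apply (integral (cbox 0 1) (F x0))) (at x0)"
    by (subst (asm) at_within_open) (use \<rho>(1) in auto)
  then have D: "((\<lambda>x. frechet_derivative g (at x) v) has_derivative
      blinfun_apply (integral (cbox 0 1) (F x0))) (at x0)"
    by (rule has_derivative_transform_within_open[of _ _ _ _ "ball x0 \<rho>"])
      (use directional_derivative_Cauchy_integral[OF g \<rho>(1) \<rho>(2)] \<rho>(1) in auto)
  \<comment> \<open>Integrability allows evaluation at a vector to pass inside the operator-valued
    integral.\<close>
  have "F x0 integrable_on cbox 0 1"
    using integrable_continuous continuous_on_compose2[OF contF cont_Pair[of x0]] \<rho>(1)
    by force
  then have ap: "blinfun_apply (integral (cbox 0 1) (F x0)) h =
      integral (cbox 0 1) (\<lambda>t. frechet_derivative g (at (x0 + ?c t *s v)) h / ?c t)" for h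
    using \<rho>(1) by (simp add: blinfun_apply_integral F)
  have "blinfun_apply (integral (cbox 0 1) (F x0)) (c *s h) =
      c * blinfun_apply (integral (cbox 0 1) (F x0)) h" for c h
    unfolding ap integral_mult_right[symmetric]
    using \<rho>(1) by (simp add: holomorphic_fun_onD(2)[OF g cU])
  with D show "\<exists>D. ((\<lambda>x. frechet_derivative g (at x) v) has_derivative D) (at x0) \<and>
      (\<forall>c v. D (c *s v) = c * D v)" by blast
qed

text \<open>Induction on the order with \<open>g\<close> arbitrary: directional derivatives are
  again holomorphic, so the hypothesis applies to them.\<close>

lemma holomorphic_fun_on_smooth:
  fixes g :: "complex ^ 'n \<Rightarrow> complex"
  assumes "holomorphic_fun_on g U" "open U"
  shows "smooth_on g U"
proof -
  have "times_cont_diff_on k g U" for k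
    using assms(1)
  proof (induction k arbitrary: g)
    case 0
    then show ?case by (simp add: holomorphic_fun_on_continuous)
  next
    case (Suc k)
    then show ?case
      using holomorphic_fun_onD(1)[OF Suc.prems] holomorphic_fun_on_derivative[OF Suc.prems assms(2)]
      by (auto simp: differentiable_def)
  qed
  then show ?thesis by (simp add: smooth_on_def)
qed

section \<open>Smoothness of holomorphic maps through their components\<close>

lemma holomorphic_map_onD:
  assumes "holomorphic_map_on F U" "x \<in> U"
  shows "(F has_derivative (\<lambda>v. frechet_derivative F (at x) v)) (at x)"
    and "frechet_derivative F (at x) (c *s v) = c *s frechet_derivative F (at x) v"
proof -
  obtain D where D: "(F has_derivative D) (at x)" "\<And>c v. D (c *s v) = c *s D v"
    using assms unfolding holomorphic_map_on_def by blast
  have "D = frechet_derivative F (at x)" using D(1) frechet_derivative_at by blast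
  with D show "(F has_derivative (\<lambda>v. frechet_derivative F (at x) v)) (at x)"
    and "frechet_derivative F (at x) (c *s v) = c *s frechet_derivative F (at x) v" by auto
qed

lemma holomorphic_map_on_component:
  assumes "holomorphic_map_on F U"
  shows "holomorphic_fun_on (\<lambda>x. F x $ j) U"
  unfolding holomorphic_fun_on_def
proof
  fix x assume "x \<in> U"
  then show "\<exists>D. ((\<lambda>x. F x $ j) has_derivative D) (at x) \<and> (\<forall>c v. D (c *s v) = c * D v)"
    using bounded_linear.has_derivative[OF bounded_linear_vec_nth holomorphic_map_onD(1)[OF assms], of x j]
      holomorphic_map_onD(2)[OF assms, of x]
    by (intro exI[of _ "\<lambda>v. frechet_derivative F (at x) v $ j"]) auto
qed

lemma holomorphic_map_on_smooth:
  assumes "holomorphic_map_on F U" "open U"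
  shows "smooth_on F U"
proof -
  have "smooth_on (\<lambda>x. \<Sum>j\<in>UNIV. F x $ j *s (axis j 1 :: C2)) U"
    by (intro smooth_on_sum smooth_on_linear[OF _ bounded_bilinear.bounded_linear_left
          [OF bounded_bilinear_vector_scalar_mult]] holomorphic_fun_on_smooth
        holomorphic_map_on_component assms) auto
  then show ?thesis by (simp add: basis_expansion)
qed

section \<open>Wirtinger derivatives along vector fields\<close>

text \<open>Valid also at points of non-differentiability: \<open>frechet_derivative\<close> is a
  choice among all derivatives, and functions agreeing near \<open>p\<close> have the same
  ones.\<close>

lemma frechet_derivative_cong_open:
  assumes "open W" "p \<in> W" "\<And>x. x \<in> W \<Longrightarrow> f x = g x"
  shows "frechet_derivative f (at p) = frechet_derivative g (at p)"
proof -
  have "(f has_derivative D) (at p) \<longleftrightarrow> (g has_derivative D) (at p)" for D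
    using has_derivative_transform_within_open[OF _ assms(1,2), of f D UNIV g]
      has_derivative_transform_within_open[OF _ assms(1,2), of g D UNIV f] assms(3) by auto
  then show ?thesis by (simp add: frechet_derivative_def)
qed

lemma vf_apply_cong:
  assumes "L p = M p" "open W" "p \<in> W" "\<And>x. x \<in> W \<Longrightarrow> f x = g x"
  shows "vf_apply L f p = vf_apply M g p"
  using frechet_derivative_cong_open[OF assms(2-4)] assms(1) by (simp add: vf_apply_def d_z_def)

lemma vf_apply_bar_cong:
  assumes "L p = M p" "open W" "p \<in> W" "\<And>x. x \<in> W \<Longrightarrow> f x = g x"
  shows "vf_apply_bar L f p = vf_apply_bar M g p"
  using frechet_derivative_cong_open[OF assms(2-4)] assms(1)
  by (simp add: vf_apply_bar_def d_zbar_def)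

text \<open>For a merely real linear \<open>D\<close> the value at \<open>\<i> *s v\<close> is not
  determined by \<open>D v\<close>; both are written in the coordinate directions that enter
  \<open>d_z\<close> and \<open>d_zbar\<close>.\<close>

lemma real_linear_C2_expansion:
  fixes D :: "C2 \<Rightarrow> complex"
  assumes "linear D"
  shows "D v = (\<Sum>j\<in>UNIV. Re (v $ j) * D (axis j 1) + Im (v $ j) * D (axis j \<i>))"
    and "D (\<i> *s v) = (\<Sum>j\<in>UNIV. Re (v $ j) * D (axis j \<i>) - Im (v $ j) * D (axis j 1))"
proof -
  have "v = (\<Sum>j\<in>UNIV. Re (v $ j) *\<^sub>R axis j 1 + Im (v $ j) *\<^sub>R axis j \<i>)"
    by (auto simp: vec_eq_iff axis_def sum_2 exhaust_2 complex_eq_iff forall_2)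
  then have "D v = D (\<Sum>j\<in>UNIV. Re (v $ j) *\<^sub>R axis j 1 + Im (v $ j) *\<^sub>R axis j \<i>)"
    by simp
  then show "D v = (\<Sum>j\<in>UNIV. Re (v $ j) * D (axis j 1) + Im (v $ j) * D (axis j \<i>))"
    by (simp add: linear_sum[OF assms] linear_add[OF assms] linear_scale[OF assms] scaleR_conv_of_real[where 'a = complex])
  have "\<i> *s v = (\<Sum>j\<in>UNIV. Re (v $ j) *\<^sub>R axis j \<i> - Im (v $ j) *\<^sub>R axis j 1)"
    by (auto simp: vec_eq_iff axis_def sum_2 exhaust_2 complex_eq_iff forall_2)
  then have "D (\<i> *s v) = D (\<Sum>j\<in>UNIV. Re (v $ j) *\<^sub>R axis j \<i> - Im (v $ j) *\<^sub>R axis j 1)"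
    by simp
  then show "D (\<i> *s v) = (\<Sum>j\<in>UNIV. Re (v $ j) * D (axis j \<i>) - Im (v $ j) * D (axis j 1))"
    by (simp add: linear_sum[OF assms] linear_diff[OF assms] linear_scale[OF assms] scaleR_conv_of_real[where 'a = complex])
qed

text \<open>Coordinate-free form of the operators: the complex linear and the antilinear part of the
  real derivative, evaluated at \<open>L p\<close>. The transformation rules below rest on
  it.\<close>

lemma
  assumes "(f has_derivative D) (at p)"
  shows vf_apply_eq: "vf_apply L f p = (D (L p) - \<i> * D (\<i> *s L p)) / 2"
    and vf_apply_bar_eq: "vf_apply_bar L f p = (D (L p) + \<i> * D (\<i> *s L p)) / 2"
proof -
  have D: "frechet_derivative f (at p) = D" using frechet_derivative_at[OF assms] by simp
  note lin = real_linear_C2_expansion[OF has_derivative_linear[OF assms], of "L p"]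
  have z: "L p $ j = Re (L p $ j) + \<i> * Im (L p $ j)"
    and c: "cnj (L p $ j) = Re (L p $ j) - \<i> * Im (L p $ j)" for j
    by (simp_all add: complex_eq_iff)
  show "vf_apply L f p = (D (L p) - \<i> * D (\<i> *s L p)) / 2"
    unfolding vf_apply_def d_z_def D lin sum_2
    by (subst z[of 1], subst z[of 2]) (simp add: algebra_simps diff_divide_distrib add_divide_distrib)
  show "vf_apply_bar L f p = (D (L p) + \<i> * D (\<i> *s L p)) / 2"
    unfolding vf_apply_bar_def d_zbar_def D lin sum_2
    by (subst c[of 1], subst c[of 2]) (simp add: algebra_simps diff_divide_distrib add_divide_distrib)
qed

lemma vf_apply_mult:
  assumes "u differentiable (at p)" "w differentiable (at p)"
  shows "vf_apply L (\<lambda>x. u x * w x) p = vf_apply L u p * w p + u p * vf_apply L w p"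
proof -
  note d = assms[THEN has_derivative_frechet_derivative]
  show ?thesis
    by (simp add: vf_apply_eq[OF has_derivative_mult[OF d]] vf_apply_eq[OF d(1)] vf_apply_eq[OF d(2)]
        field_simps)
qed

lemma vf_apply_sum:
  assumes "\<And>k. k \<in> I \<Longrightarrow> f k differentiable (at p)"
  shows "vf_apply L (\<lambda>x. \<Sum>k\<in>I. f k x) p = (\<Sum>k\<in>I. vf_apply L (f k) p)"
proof -
  note d = has_derivative_frechet_derivative[OF assms]
  have "((\<lambda>x. \<Sum>k\<in>I. f k x) has_derivative (\<lambda>v. \<Sum>k\<in>I. frechet_derivative (f k) (at p) v)) (at p)"
    by (rule has_derivative_sum) (rule d)
  from vf_apply_eq[OF this] show ?thesis
    by (simp add: vf_apply_eq[OF d] sum_distrib_left sum_subtractf flip: sum_divide_distrib)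
qed

text \<open>The derivative of a conjugated holomorphic function is antilinear, so its complex linear
  part is zero.\<close>

lemma vf_apply_cnj_holomorphic:
  assumes "holomorphic_fun_on u X" "p \<in> X"
  shows "vf_apply L (\<lambda>x. cnj (u x)) p = 0"
  by (simp add: vf_apply_eq[OF bounded_linear.has_derivative[OF bounded_linear_cnj
        holomorphic_fun_onD(1)[OF assms]]] holomorphic_fun_onD(2)[OF assms])

lemma complex_hessian_eq_vf_apply:
  "complex_hessian f A B p = (\<Sum>k\<in>UNIV. cnj (B p $ k) * vf_apply A (d_zbar k f) p)"
  unfolding complex_hessian_def vf_apply_def
  by (subst sum.swap) (simp add: sum_distrib_left mult_ac)

text \<open>Freezing \<open>B\<close> at its value at \<open>p\<close> removes the first-order term
  that differentiating its coefficients would produce.\<close>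

lemma complex_hessian_eq_iterated:
  assumes "\<And>k. d_zbar k f differentiable (at p)"
  shows "complex_hessian f A B p = vf_apply A (vf_apply_bar (\<lambda>_. B p) f) p"
  unfolding vf_apply_bar_def
  by (subst vf_apply_sum)
    (auto simp: vf_apply_mult assms complex_hessian_eq_vf_apply vf_apply_eq[OF has_derivative_const])

section \<open>Smoothness of Wirtinger derivatives and of the complex Hessian\<close>

lemma smooth_on_mult:
  fixes f g :: "'a::euclidean_space \<Rightarrow> complex"
  shows "open U \<Longrightarrow> smooth_on f U \<Longrightarrow> smooth_on g U \<Longrightarrow> smooth_on (\<lambda>x. f x * g x) U"
  by (rule smooth_on_bilinear[OF _ bounded_bilinear_mult])

lemma smooth_on_cnj: "open U \<Longrightarrow> smooth_on f U \<Longrightarrow> smooth_on (\<lambda>x. cnj (f x)) U"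
  by (rule smooth_on_linear[OF _ bounded_linear_cnj])

lemma smooth_on_nth:
  fixes L :: "'a::euclidean_space \<Rightarrow> C2"
  shows "open U \<Longrightarrow> smooth_on L U \<Longrightarrow> smooth_on (\<lambda>x. L x $ j) U"
  by (rule smooth_on_linear[OF _ bounded_linear_vec_nth])

lemma smooth_on_cplx: "open U \<Longrightarrow> smooth_on r U \<Longrightarrow> smooth_on (cplx r) U"
  by (rule smooth_on_linear[OF _ bounded_linear_of_real])

lemma smooth_on_d_z:
  assumes "open U" "smooth_on f U" shows "smooth_on (d_z j f) U"
proof -
  have "smooth_on (\<lambda>p. (1/2) * frechet_derivative f (at p) (axis j 1)
      + (- \<i>/2) * frechet_derivative f (at p) (axis j \<i>)) U"
    by (intro smooth_on_add smooth_on_linear[OF _ bounded_linear_mult_right]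
        smooth_on_frechet_derivative assms)
  then show ?thesis
    by (rule smooth_on_cong[OF assms(1), rotated]) (simp add: d_z_def field_simps)
qed

lemma smooth_on_d_zbar:
  assumes "open U" "smooth_on f U" shows "smooth_on (d_zbar j f) U"
proof -
  have "smooth_on (\<lambda>p. (1/2) * frechet_derivative f (at p) (axis j 1)
      + (\<i>/2) * frechet_derivative f (at p) (axis j \<i>)) U"
    by (intro smooth_on_add smooth_on_linear[OF _ bounded_linear_mult_right]
        smooth_on_frechet_derivative assms)
  then show ?thesis
    by (rule smooth_on_cong[OF assms(1), rotated]) (simp add: d_zbar_def field_simps)
qed

lemma smooth_on_vf_apply_bar:
  "open U \<Longrightarrow> smooth_on L U \<Longrightarrow> smooth_on f U \<Longrightarrow> smooth_on (vf_apply_bar L f) U"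
  unfolding vf_apply_bar_def [abs_def]
  by (intro smooth_on_sum smooth_on_mult smooth_on_cnj smooth_on_nth smooth_on_d_zbar) auto

lemma smooth_on_vf_apply:
  "open U \<Longrightarrow> smooth_on L U \<Longrightarrow> smooth_on f U \<Longrightarrow> smooth_on (vf_apply L f) U"
  unfolding vf_apply_def [abs_def]
  by (intro smooth_on_sum smooth_on_mult smooth_on_nth smooth_on_d_z) auto

lemma smooth_on_complex_hessian:
  "open U \<Longrightarrow> smooth_on f U \<Longrightarrow> smooth_on A U \<Longrightarrow> smooth_on B U
    \<Longrightarrow> smooth_on (complex_hessian f A B) U"
  unfolding complex_hessian_def [abs_def]
  by (intro smooth_on_sum smooth_on_mult smooth_on_cnj smooth_on_nth smooth_on_d_z smooth_on_d_zbar)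
    auto

section \<open>Transport along a biholomorphic map\<close>

text \<open>The field that \<open>F\<close> carries to \<open>L\<close>. Using the derivative of the
  inverse map \<open>G\<close> instead of an inverted Jacobian reduces its smoothness to that of
  composites.\<close>

definition pullback_vf :: "(C2 \<Rightarrow> C2) \<Rightarrow> (C2 \<Rightarrow> C2) \<Rightarrow> (C2 \<Rightarrow> C2) \<Rightarrow> C2 \<Rightarrow> C2" where
  "pullback_vf F G L p = frechet_derivative G (at (F p)) (L (F p))"

text \<open>The data are symmetric in the two maps, so \<open>swap\<close> yields pushforwards and
  converse implications; the sets are arbitrary, so complements can be substituted.\<close>

locale biholomorphic_boundary_pair =
  fixes F G :: "C2 \<Rightarrow> C2" and X Y S' S :: "C2 set"
  assumes open_X: "open X" and open_Y: "open Y"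
    and hol_F: "holomorphic_map_on F X" and hol_G: "holomorphic_map_on G Y"
    and F_in: "x \<in> X \<Longrightarrow> F x \<in> Y" and G_in: "y \<in> Y \<Longrightarrow> G y \<in> X"
    and GF: "x \<in> X \<Longrightarrow> G (F x) = x" and FG: "y \<in> Y \<Longrightarrow> F (G y) = y"
    and mem_iff: "x \<in> X \<Longrightarrow> x \<in> S' \<longleftrightarrow> F x \<in> S"
begin

lemma swap: "biholomorphic_boundary_pair G F Y X S S'"
  by unfold_locales (use open_X open_Y hol_F hol_G F_in G_in GF FG mem_iff in auto)

abbreviation pre :: "C2 set \<Rightarrow> C2 set" where
  "pre V \<equiv> {x \<in> X. F x \<in> V}"

lemma F_differentiable: "x \<in> X \<Longrightarrow> F differentiable (at x)"
  using holomorphic_map_onD(1)[OF hol_F] differentiable_def by blast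

lemma continuous_F: "continuous_on X F"
  by (intro continuous_at_imp_continuous_on ballI differentiable_imp_continuous_within F_differentiable)

lemma open_pre: "open V \<Longrightarrow> open (pre V)"
  using continuous_open_preimage[OF continuous_F open_X, of V] by (simp add: vimage_def Int_def)

text \<open>Chain rule for \<open>G (F x)\<close>, which is the identity on the open set
  \<open>X\<close>, and uniqueness of derivatives.\<close>

lemma DG_DF:
  assumes "x \<in> X"
  shows "frechet_derivative G (at (F x)) (frechet_derivative F (at x) v) = v"
proof -
  have "((\<lambda>x. G (F x)) has_derivative
      (\<lambda>v. frechet_derivative G (at (F x)) (frechet_derivative F (at x) v))) (at x)"
    using diff_chain_at[OF holomorphic_map_onD(1)[OF hol_F assms]
        holomorphic_map_onD(1)[OF hol_G F_in[OF assms]]] by (simp add: o_def)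
  then have "((\<lambda>x. x) has_derivative
      (\<lambda>v. frechet_derivative G (at (F x)) (frechet_derivative F (at x) v))) (at x)"
    by (rule has_derivative_transform_within_open[OF _ open_X assms]) (rule GF)
  from has_derivative_unique[OF this has_derivative_ident] show ?thesis by metis
qed

lemma DF_DG:
  assumes "x \<in> X"
  shows "frechet_derivative F (at x) (frechet_derivative G (at (F x)) v) = v"
  using biholomorphic_boundary_pair.DG_DF[OF swap F_in[OF assms], of v] GF[OF assms] by simp

lemma DF_pullback: "x \<in> X \<Longrightarrow> frechet_derivative F (at x) (pullback_vf F G L x) = L (F x)"
  by (simp add: pullback_vf_def DF_DG)

lemma smooth_compose_F: "open V \<Longrightarrow> smooth_on f V \<Longrightarrow> smooth_on (\<lambda>x. f (F x)) (pre V)"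
  by (rule smooth_on_compose[OF open_pre])
    (auto intro: smooth_on_subset[OF holomorphic_map_on_smooth[OF hol_F open_X]])

lemma smooth_pullback:
  assumes "open V" "smooth_on L V"
  shows "smooth_on (pullback_vf F G L) (pre V)"
proof -
  have "smooth_on (\<lambda>x. \<Sum>b\<in>Basis. (L (F x) \<bullet> b) *\<^sub>R frechet_derivative G (at (F x)) b) (pre V)"
  proof (intro smooth_on_sum smooth_on_bilinear[OF _ bounded_bilinear_scaleR])
    fix b :: C2
    show "smooth_on (\<lambda>x. L (F x) \<bullet> b) (pre V)"
      by (rule smooth_on_linear[OF open_pre bounded_linear_inner_left smooth_compose_F])
        (use assms in auto)
    have "smooth_on (\<lambda>x. frechet_derivative G (at (F x)) b) (pre Y)"
      by (rule smooth_compose_F[OF open_Y smooth_on_frechet_derivative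
            [OF holomorphic_map_on_smooth[OF hol_G open_Y]]])
    then show "smooth_on (\<lambda>x. frechet_derivative G (at (F x)) b) (pre V)"
      by (rule smooth_on_subset) (auto intro: F_in)
  qed (use open_pre assms in auto)
  then show ?thesis
  proof (rule smooth_on_cong[OF open_pre[OF assms(1)], rotated])
    fix x assume "x \<in> pre V"
    then have "G differentiable (at (F x))"
      using smooth_on_differentiable[OF holomorphic_map_on_smooth[OF hol_G open_Y]] F_in by auto
    then show "(\<Sum>b\<in>Basis. (L (F x) \<bullet> b) *\<^sub>R frechet_derivative G (at (F x)) b) = pullback_vf F G L x"
      unfolding pullback_vf_def by (rule frechet_derivative_basis_expansion[symmetric])
  qed
qed

text \<open>The derivative of \<open>F\<close> commutes with multiplication by \<open>\<i>\<close>,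
  so it respects the splitting into complex linear and antilinear parts. The fields need be related
  only at the one point \<open>x\<close>, which admits frozen fields.\<close>

lemma
  assumes "x \<in> X" "f differentiable (at (F x))" "frechet_derivative F (at x) (M x) = L (F x)"
  shows vf_apply_compose: "vf_apply M (\<lambda>x. f (F x)) x = vf_apply L f (F x)"
    and vf_apply_bar_compose: "vf_apply_bar M (\<lambda>x. f (F x)) x = vf_apply_bar L f (F x)"
proof -
  note df = has_derivative_frechet_derivative[OF assms(2)]
  have d: "((\<lambda>x. f (F x)) has_derivative
      (\<lambda>v. frechet_derivative f (at (F x)) (frechet_derivative F (at x) v))) (at x)"
    using diff_chain_at[OF holomorphic_map_onD(1)[OF hol_F assms(1)] df] by (simp add: o_def)
  show "vf_apply M (\<lambda>x. f (F x)) x = vf_apply L f (F x)"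
    by (simp add: vf_apply_eq[OF d] vf_apply_eq[OF df] holomorphic_map_onD(2)[OF hol_F assms(1)] assms(3))
  show "vf_apply_bar M (\<lambda>x. f (F x)) x = vf_apply_bar L f (F x)"
    by (simp add: vf_apply_bar_eq[OF d] vf_apply_bar_eq[OF df] holomorphic_map_onD(2)[OF hol_F assms(1)] assms(3))
qed

text \<open>The Jacobian of \<open>F\<close> enters the inner derivative through conjugates of holomorphic functions,
  which the outer \<open>(1,0)\<close> derivative annihilates; hence no second derivative of \<open>F\<close> appears.\<close>

lemma complex_hessian_compose:
  assumes x: "x \<in> X" and V: "open V" "F x \<in> V" and f: "smooth_on f V"
    and A: "frechet_derivative F (at x) (A' x) = A (F x)"
    and B: "frechet_derivative F (at x) (B' x) = B (F x)"
  shows "complex_hessian (\<lambda>x. f (F x)) A' B' x = complex_hessian f A B (F x)"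
proof -
  \<comment> \<open>Only the value of \<open>B'\<close> at \<open>x\<close> enters the Hessian, so
    the constant field \<open>b\<close> may replace it; its image under the derivative of
    \<open>F\<close> has holomorphic components \<open>u k\<close>.\<close>
  define b where "b = B' x"
  define u where "u k y = frechet_derivative F (at y) b $ k" for k y
  have u: "holomorphic_fun_on (u k) X" for k
    unfolding holomorphic_fun_on_def
  proof
    fix y assume y: "y \<in> X"
    have eq: "u k y = frechet_derivative (\<lambda>x. F x $ k) (at y) b" if "y \<in> X" for y
      using frechet_derivative_eqI[OF bounded_linear.has_derivative[OF bounded_linear_vec_nth
            holomorphic_map_onD(1)[OF hol_F that]], of k b] by (simp add: u_def)
    obtain D where D: "((\<lambda>y. frechet_derivative (\<lambda>x. F x $ k) (at y) b) has_derivative D) (at y)"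
      "\<forall>c v. D (c *s v) = c * D v"
      using holomorphic_fun_on_derivative[OF holomorphic_map_on_component[OF hol_F] open_X] y
      unfolding holomorphic_fun_on_def by blast
    from has_derivative_transform_within_open[OF D(1) open_X y, of "u k"] D(2) eq
    show "\<exists>D. (u k has_derivative D) (at y) \<and> (\<forall>c v. D (c *s v) = c * D v)" by auto
  qed
  have dcu: "(\<lambda>y. cnj (u k y)) differentiable (at x)" for k
    using bounded_linear.has_derivative[OF bounded_linear_cnj holomorphic_fun_onD(1)[OF u x]]
      differentiable_def by blast
  have xV: "x \<in> pre V" using x V by simp
  note opre = open_pre[OF V(1)]
  have w: "smooth_on (\<lambda>y. d_zbar k f (F y)) (pre V)" for k
    by (intro smooth_compose_F smooth_on_d_zbar V f)
  \<comment> \<open>This is needed on a whole neighbourhood of \<open>x\<close>, since the outer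
    derivative is still to be taken.\<close>
  have inner: "vf_apply_bar (\<lambda>_. b) (\<lambda>x. f (F x)) y = (\<Sum>k\<in>UNIV. cnj (u k y) * d_zbar k f (F y))"
    if "y \<in> pre V" for y
    using vf_apply_bar_compose[of y f "\<lambda>_. b" "\<lambda>_. frechet_derivative F (at y) b"] that
      smooth_on_differentiable[OF f]
    by (simp add: vf_apply_bar_def u_def)
  have "complex_hessian (\<lambda>x. f (F x)) A' B' x
      = vf_apply A' (vf_apply_bar (\<lambda>_. b) (\<lambda>x. f (F x))) x"
    unfolding b_def
    by (rule complex_hessian_eq_iterated)
      (rule smooth_on_differentiable[OF smooth_on_d_zbar[OF opre smooth_compose_F[OF V(1) f]] xV])
  also have "\<dots> = vf_apply A' (\<lambda>y. \<Sum>k\<in>UNIV. cnj (u k y) * d_zbar k f (F y)) x"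
    by (rule vf_apply_cong[OF refl opre xV inner])
  also have "\<dots> = (\<Sum>k\<in>UNIV. cnj (u k x) * vf_apply A' (\<lambda>y. d_zbar k f (F y)) x)"
    using smooth_on_differentiable[OF w xV] dcu
    by (subst vf_apply_sum) (simp_all add: vf_apply_mult vf_apply_cnj_holomorphic[OF u x])
  also have "\<dots> = (\<Sum>k\<in>UNIV. cnj (B (F x) $ k) * vf_apply A (d_zbar k f) (F x))"
  proof (rule sum.cong[OF refl])
    fix k
    have "vf_apply A' (\<lambda>y. d_zbar k f (F y)) x = vf_apply A (d_zbar k f) (F x)"
      by (rule vf_apply_compose[where f = "d_zbar k f" and L = A and M = A' and x = x, OF x _ A])
        (rule smooth_on_differentiable[OF smooth_on_d_zbar[OF V(1) f] V(2)])
    then show "cnj (u k x) * vf_apply A' (\<lambda>y. d_zbar k f (F y)) x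
        = cnj (B (F x) $ k) * vf_apply A (d_zbar k f) (F x)"
      by (simp add: u_def b_def B)
  qed
  finally show ?thesis by (simp add: complex_hessian_eq_vf_apply)
qed

end

section \<open>Invariance of the boundary, of defining functions and of tangential fields\<close>

lemma interior_image_biholomorphic:
  assumes "biholomorphic_boundary_pair F G X Y S' S" "x \<in> X" "x \<in> interior S'"
  shows "F x \<in> interior S"
proof -
  interpret biholomorphic_boundary_pair F G X Y S' S by fact
  interpret inv: biholomorphic_boundary_pair G F Y X S S' by (rule swap)
  \<comment> \<open>The preimage of the interior under \<open>G\<close> is an open neighbourhood of
    \<open>F x\<close> inside \<open>S\<close>.\<close>
  have "open (inv.pre (interior S'))" by (rule inv.open_pre) simp
  moreover have "F x \<in> inv.pre (interior S')" using assms by (simp add: F_in GF)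
  moreover have "inv.pre (interior S') \<subseteq> S"
    using inv.mem_iff interior_subset by auto
  ultimately show ?thesis by (rule interiorI)
qed

context biholomorphic_boundary_pair
begin

text \<open>A frontier point is interior neither to the set nor to its complement, and both
  interiors are preserved, the second by passing to the pair of complements.\<close>

lemma frontier_iff:
  assumes "x \<in> X" shows "x \<in> frontier S' \<longleftrightarrow> F x \<in> frontier S"
proof -
  have compl: "biholomorphic_boundary_pair F G X Y (- S') (- S)"
    by unfold_locales (use open_X open_Y hol_F hol_G F_in G_in GF FG mem_iff in auto)
  have "x \<in> interior S' \<longleftrightarrow> F x \<in> interior S"
    using interior_image_biholomorphic[OF biholomorphic_boundary_pair_axioms assms]
      interior_image_biholomorphic[OF swap F_in[OF assms]] GF[OF assms] by auto
  moreover have "x \<in> interior (- S') \<longleftrightarrow> F x \<in> interior (- S)"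
    using interior_image_biholomorphic[OF compl assms]
      interior_image_biholomorphic[OF biholomorphic_boundary_pair.swap[OF compl] F_in[OF assms]]
      GF[OF assms] by auto
  ultimately show ?thesis by (simp add: frontier_def closure_interior)
qed

lemma local_defining_function_compose:
  assumes "p \<in> X" "local_defining_function S (F p) V r"
  shows "local_defining_function S' p (pre V) (\<lambda>x. r (F x))"
  unfolding local_defining_function_def
proof (intro conjI ballI)
  have V: "open V" "F p \<in> V" "smooth_on r V" and S: "S \<inter> V = {q \<in> V. r q < 0}"
    and dr: "\<And>q. q \<in> frontier S \<inter> V \<Longrightarrow> \<exists>v. frechet_derivative r (at q) v \<noteq> 0"
    using assms(2) unfolding local_defining_function_def by auto
  show "open (pre V)" "smooth_on (\<lambda>x. r (F x)) (pre V)" "p \<in> pre V"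
    using V assms(1) by (auto intro: open_pre smooth_compose_F)
  show "S' \<inter> pre V = {q \<in> pre V. r (F q) < 0}" using S mem_iff by auto
  fix q assume q: "q \<in> frontier S' \<inter> pre V"
  then obtain v where v: "frechet_derivative r (at (F q)) v \<noteq> 0"
    using dr frontier_iff by auto
  have "((\<lambda>x. r (F x)) has_derivative
      (\<lambda>v. frechet_derivative r (at (F q)) (frechet_derivative F (at q) v))) (at q)"
    using diff_chain_at[OF holomorphic_map_onD(1)[where x = q, OF hol_F]
        has_derivative_frechet_derivative[OF smooth_on_differentiable[where x = "F q", OF V(3)]]] q
    by (simp add: o_def)
  \<comment> \<open>The derivative of \<open>F\<close> sends this test vector back to
    \<open>v\<close>, where the differential of \<open>r\<close> is nonzero.\<close>
  from frechet_derivative_eqI[OF this, of "frechet_derivative G (at (F q)) v"] v q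
  show "\<exists>v. frechet_derivative (\<lambda>x. r (F x)) (at q) v \<noteq> 0"
    by (metis (no_types, lifting) DF_DG IntD2 mem_Collect_eq)
qed

lemma tangential_vf_pullback:
  assumes "p \<in> X" "smooth_on r V" "tangential_vf S (F p) V r L"
  shows "tangential_vf S' p (pre V) (\<lambda>x. r (F x)) (pullback_vf F G L)"
  unfolding tangential_vf_def
proof (intro conjI ballI)
  have V: "open V" "F p \<in> V" "smooth_on L V"
    and t: "\<And>q. q \<in> frontier S \<inter> V \<Longrightarrow> vf_apply L (cplx r) q = 0"
    using assms(3) unfolding tangential_vf_def by auto
  show "open (pre V)" "smooth_on (pullback_vf F G L) (pre V)" "p \<in> pre V"
    using V assms(1) by (auto intro: open_pre smooth_pullback)
  fix q assume q: "q \<in> frontier S' \<inter> pre V"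
  then have "vf_apply (pullback_vf F G L) (cplx (\<lambda>x. r (F x))) q = vf_apply L (cplx r) (F q)"
    by (intro vf_apply_compose smooth_on_differentiable[OF smooth_on_cplx[OF V(1) assms(2)]]
        DF_pullback) auto
  then show "vf_apply (pullback_vf F G L) (cplx (\<lambda>x. r (F x))) q = 0"
    using q t frontier_iff by auto
qed

lemma pullback_vf_nonzero:
  assumes "x \<in> X" "L (F x) \<noteq> 0" shows "pullback_vf F G L x \<noteq> 0"
proof
  assume "pullback_vf F G L x = 0"
  then have "L (F x) = frechet_derivative F (at x) 0" using DF_pullback[OF assms(1), of L] by simp
  then show False
    using linear_0[OF linear_frechet_derivative[OF F_differentiable[OF assms(1)]]] assms(2) by simp
qed

end

text \<open>Pulling back by \<open>F\<close> and then by \<open>G\<close> produces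
  \<open>r (F (G y))\<close>, which agrees with \<open>r y\<close> only on the set in
  question.\<close>

lemma tangential_vf_cong:
  assumes "tangential_vf \<Omega> p V r L" "\<And>x. x \<in> V \<Longrightarrow> r x = s x"
  shows "tangential_vf \<Omega> p V s L"
  using assms(1) vf_apply_cong[of L _ L V "cplx s" "cplx r"] assms(2)
  unfolding tangential_vf_def by auto

section \<open>Pushforward of fields and invariance of the Levi conditions\<close>

context biholomorphic_boundary_pair
begin

text \<open>The Levi conditions for \<open>S'\<close> quantify over all tangential fields there, so
  each of them must be matched with a field for \<open>S\<close>: its pullback along the inverse
  map.\<close>

lemma tangential_vf_pushforward:
  assumes p: "p \<in> X" and V: "open V" "smooth_on r V"
    and sub: "V' \<subseteq> pre V" and M: "tangential_vf S' p V' (\<lambda>x. r (F x)) M"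
  obtains V'' L where "V'' \<subseteq> V" "tangential_vf S (F p) V'' r L"
    "(\<forall>q\<in>V'. M q \<noteq> 0) \<Longrightarrow> (\<forall>q\<in>V''. L q \<noteq> 0)"
    "\<And>x. x \<in> pre V \<Longrightarrow>
      complex_hessian (cplx (\<lambda>x. r (F x))) M M x = complex_hessian (cplx r) L L (F x)"
proof -
  interpret inv: biholomorphic_boundary_pair G F Y X S S' by (rule swap)
  let ?L = "pullback_vf G F M"
  show thesis
  proof (rule that)
    show "inv.pre V' \<subseteq> V" using sub FG by auto
    have "smooth_on (\<lambda>x. r (F x)) V'"
      by (rule smooth_on_subset[OF smooth_compose_F[OF V] sub])
    then have "tangential_vf S (F p) (inv.pre V') (\<lambda>y. r (F (G y))) ?L"
      by (rule inv.tangential_vf_pullback[OF F_in[OF p]]) (simp add: GF[OF p] M)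
    then show "tangential_vf S (F p) (inv.pre V') r ?L"
      by (rule tangential_vf_cong) (simp add: FG)
    show "\<forall>q\<in>inv.pre V'. ?L q \<noteq> 0" if "\<forall>q\<in>V'. M q \<noteq> 0"
      using inv.pullback_vf_nonzero that by auto
    show "complex_hessian (cplx (\<lambda>x. r (F x))) M M x = complex_hessian (cplx r) ?L ?L (F x)"
      if "x \<in> pre V" for x
      by (rule complex_hessian_compose[OF _ V(1) _ smooth_on_cplx[OF V]])
        (use that in \<open>auto simp: pullback_vf_def GF\<close>)
  qed
qed

lemma eventually_nhds_compose_F:
  assumes "p \<in> X" "eventually P (nhds (F p))"
  shows "\<forall>\<^sub>F x in nhds p. x \<in> X \<and> P (F x)"
proof -
  obtain T where T: "open T" "F p \<in> T" "\<And>y. y \<in> T \<Longrightarrow> P y"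
    using assms(2) by (auto simp: eventually_nhds)
  show ?thesis
    unfolding eventually_nhds
    by (rule exI[of _ "pre T"]) (use T assms(1) open_pre in auto)
qed

lemma levi_nonneg_compose:
  assumes p: "p \<in> X" and V: "open V" "F p \<in> V" "smooth_on r V" and lv: "levi_nonneg S (F p) V r"
  shows "levi_nonneg S' p (pre V) (\<lambda>x. r (F x))"
  unfolding levi_nonneg_def
proof (intro allI impI, elim conjE)
  fix V' M assume M: "V' \<subseteq> pre V" "tangential_vf S' p V' (\<lambda>x. r (F x)) M"
  obtain V'' L where L: "V'' \<subseteq> V" "tangential_vf S (F p) V'' r L"
    and h: "\<And>x. x \<in> pre V \<Longrightarrow>
      complex_hessian (cplx (\<lambda>x. r (F x))) M M x = complex_hessian (cplx r) L L (F x)"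
    by (rule tangential_vf_pushforward[OF p V(1,3) M(1,2)]) (rule that; assumption)
  have "\<forall>\<^sub>F y in nhds (F p). y \<in> frontier S \<longrightarrow> Re (complex_hessian (cplx r) L L y) \<ge> 0"
    using lv[unfolded levi_nonneg_def, THEN spec, THEN spec, THEN mp, OF conjI[OF L(1,2)]] .
  \<comment> \<open>Membership in \<open>V\<close> is added so that the nearby points lie in
    \<open>pre V\<close>, where the Hessian identity \<open>h\<close> holds.\<close>
  with eventually_nhds_in_open[OF V(1,2)]
  have "\<forall>\<^sub>F y in nhds (F p). y \<in> V \<and> (y \<in> frontier S \<longrightarrow> Re (complex_hessian (cplx r) L L y) \<ge> 0)"
    by (rule eventually_conj)
  from eventually_nhds_compose_F[OF p this]
  show "\<forall>\<^sub>F q in nhds p. q \<in> frontier S' \<longrightarrow>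
      Re (complex_hessian (cplx (\<lambda>x. r (F x))) M M q) \<ge> 0"
    by (rule eventually_mono) (use h frontier_iff in auto)
qed

lemma levi_pos_compose:
  assumes p: "p \<in> X" and V: "open V" "F p \<in> V" "smooth_on r V" and lv: "levi_pos S (F p) V r"
  shows "levi_pos S' p (pre V) (\<lambda>x. r (F x))"
  unfolding levi_pos_def
proof (intro allI impI, elim conjE)
  fix V' M assume M: "V' \<subseteq> pre V" "tangential_vf S' p V' (\<lambda>x. r (F x)) M" "\<forall>q\<in>V'. M q \<noteq> 0"
  obtain V'' L where L: "V'' \<subseteq> V" "tangential_vf S (F p) V'' r L" "\<forall>q\<in>V''. L q \<noteq> 0"
    and h: "\<And>x. x \<in> pre V \<Longrightarrow>
      complex_hessian (cplx (\<lambda>x. r (F x))) M M x = complex_hessian (cplx r) L L (F x)"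
    by (rule tangential_vf_pushforward[OF p V(1,3) M(1,2)]) (rule that; use M(3) in simp)
  have "\<forall>\<^sub>F y in nhds (F p). y \<in> frontier S \<longrightarrow> Re (complex_hessian (cplx r) L L y) > 0"
    using lv[unfolded levi_pos_def, THEN spec, THEN spec, THEN mp, OF conjI[OF L(1) conjI[OF L(2,3)]]] .
  with eventually_nhds_in_open[OF V(1,2)]
  have "\<forall>\<^sub>F y in nhds (F p). y \<in> V \<and> (y \<in> frontier S \<longrightarrow> Re (complex_hessian (cplx r) L L y) > 0)"
    by (rule eventually_conj)
  from eventually_nhds_compose_F[OF p this]
  show "\<forall>\<^sub>F q in nhds p. q \<in> frontier S' \<longrightarrow>
      Re (complex_hessian (cplx (\<lambda>x. r (F x))) M M q) > 0"
    by (rule eventually_mono) (use h frontier_iff in auto)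
qed

section \<open>Invariance of pseudoconvexity and of strict type 4\<close>

lemma pseudoconvex_at_pullback:
  assumes "p \<in> X" "pseudoconvex_at S (F p)" shows "pseudoconvex_at S' p"
proof -
  obtain V r where r: "local_defining_function S (F p) V r" "levi_nonneg S (F p) V r"
    and "F p \<in> frontier S"
    using assms(2) unfolding pseudoconvex_at_def by blast
  then have "p \<in> frontier S'" using frontier_iff[OF assms(1)] by simp
  moreover have "open V" "F p \<in> V" "smooth_on r V"
    using r(1) unfolding local_defining_function_def by blast+
  ultimately show ?thesis
    unfolding pseudoconvex_at_def
    using local_defining_function_compose[OF assms(1) r(1)] levi_nonneg_compose[OF assms(1) _ _ _ r(2)]
    by blast
qed

lemma strictly_pseudoconvex_at_pullback:
  assumes "p \<in> X" "strictly_pseudoconvex_at S (F p)" shows "strictly_pseudoconvex_at S' p"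
proof -
  obtain V r where r: "local_defining_function S (F p) V r" "levi_nonneg S (F p) V r"
    "levi_pos S (F p) V r" and "F p \<in> frontier S"
    using assms(2) unfolding strictly_pseudoconvex_at_def by blast
  then have "p \<in> frontier S'" using frontier_iff[OF assms(1)] by simp
  moreover have "open V" "F p \<in> V" "smooth_on r V"
    using r(1) unfolding local_defining_function_def by blast+
  ultimately show ?thesis
    unfolding strictly_pseudoconvex_at_def
    using local_defining_function_compose[OF assms(1) r(1)] levi_nonneg_compose[OF assms(1) _ _ _ r(2)]
      levi_pos_compose[OF assms(1) _ _ _ r(3)]
    by blast
qed

text \<open>The negated half runs backwards: strict pseudoconvexity at \<open>p\<close> would be
  carried by \<open>G\<close> to \<open>F p\<close>.\<close>

lemma weakly_pseudoconvex_at_pullback: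
  assumes "p \<in> X" "weakly_pseudoconvex_at S (F p)" shows "weakly_pseudoconvex_at S' p"
  using assms pseudoconvex_at_pullback GF
    biholomorphic_boundary_pair.strictly_pseudoconvex_at_pullback[OF swap F_in[OF assms(1)]]
  unfolding weakly_pseudoconvex_at_def by auto

lemma strict_type_4_pullback:
  assumes p: "p \<in> X" and st: "strict_type_4 S (F p)" shows "strict_type_4 S' p"
proof -
  obtain V r L where r: "local_defining_function S (F p) V r" and t: "tangential_vf S (F p) V r L"
    and nz: "\<forall>q\<in>V. L q \<noteq> 0"
    and ineq: "Re (vf_apply L (vf_apply_bar L (complex_hessian (cplx r) L L)) (F p))
      > cmod (vf_apply L (vf_apply L (complex_hessian (cplx r) L L)) (F p))"
    using st unfolding strict_type_4_def Let_def by blast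
  have V: "open V" "F p \<in> V" "smooth_on r V" and L: "smooth_on L V"
    using r t unfolding local_defining_function_def tangential_vf_def by blast+
  let ?lam = "complex_hessian (cplx r) L L"
  let ?M = "pullback_vf F G L"
  let ?lam' = "complex_hessian (cplx (\<lambda>x. r (F x))) ?M ?M"
  have lam: "?lam' x = ?lam (F x)" if "x \<in> pre V" for x
    by (rule complex_hessian_compose[OF _ V(1) _ smooth_on_cplx[OF V(1,3)]])
      (use that in \<open>auto simp: DF_pullback\<close>)
  note opre = open_pre[OF V(1)]
  have pV: "p \<in> pre V" using p V by simp
  have slam: "smooth_on ?lam V"
    by (intro smooth_on_complex_hessian smooth_on_cplx V L)
  \<comment> \<open>The relation between \<open>h'\<close> and \<open>h\<close> is assumed
    throughout \<open>pre V\<close> and the conclusion holds at each of its points, so this fact can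
    be applied to its own result; two rounds give the second-order expressions.\<close>
  have iter: "vf_apply ?M h' x = vf_apply L h (F x)" "vf_apply_bar ?M h' x = vf_apply_bar L h (F x)"
    if h: "smooth_on h V" "\<And>x. x \<in> pre V \<Longrightarrow> h' x = h (F x)" and x: "x \<in> pre V"
    for h h' :: "C2 \<Rightarrow> complex" and x
  proof -
    have d: "x \<in> X" "h differentiable (at (F x))" "frechet_derivative F (at x) (?M x) = L (F x)"
      using x smooth_on_differentiable[OF h(1)] DF_pullback by auto
    have "vf_apply ?M h' x = vf_apply ?M (\<lambda>x. h (F x)) x"
      "vf_apply_bar ?M h' x = vf_apply_bar ?M (\<lambda>x. h (F x)) x"
      by (rule vf_apply_cong[OF _ opre x] vf_apply_bar_cong[OF _ opre x]; use h(2) in auto)+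
    with vf_apply_compose[where f = h and L = L and M = ?M and x = x, OF d]
      vf_apply_bar_compose[where f = h and L = L and M = ?M and x = x, OF d]
    show "vf_apply ?M h' x = vf_apply L h (F x)" "vf_apply_bar ?M h' x = vf_apply_bar L h (F x)"
      by simp_all
  qed
  have "Re (vf_apply ?M (vf_apply_bar ?M ?lam') p) > cmod (vf_apply ?M (vf_apply ?M ?lam') p)"
    using ineq iter(1)[OF smooth_on_vf_apply_bar[OF V(1) L slam] iter(2)[OF slam lam] pV]
      iter(1)[OF smooth_on_vf_apply[OF V(1) L slam] iter(1)[OF slam lam] pV] by simp
  moreover have "weakly_pseudoconvex_at S' p"
    using st weakly_pseudoconvex_at_pullback[OF p] unfolding strict_type_4_def by blast
  moreover have "\<forall>q\<in>pre V. ?M q \<noteq> 0" using nz pullback_vf_nonzero by auto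
  ultimately show ?thesis
    unfolding strict_type_4_def Let_def
    using local_defining_function_compose[OF p r] tangential_vf_pullback[OF p V(3) t] by blast
qed

end

theorem lemma4p14:
  fixes \<Omega>' \<Omega> U' U :: "(complex ^ 2) set" and p0' p0 :: "complex ^ 2"
    and \<Phi> :: "complex ^ 2 \<Rightarrow> complex ^ 2"
  assumes "smoothly_bounded_domain \<Omega>'" and "smoothly_bounded_domain \<Omega>"
    and "p0' \<in> frontier \<Omega>'" and "p0 \<in> frontier \<Omega>"
    and "pseudoconvex_near \<Omega>' p0'" and "pseudoconvex_near \<Omega> p0"
    and "p0' \<in> U'" and "p0 \<in> U"
    and "biholomorphic_map \<Phi> U' U"
    and "\<Phi> ` (\<Omega>' \<inter> U') = \<Omega> \<inter> U"
    and "\<Phi> p0' = p0"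
  shows "strict_type_4 \<Omega>' p0' \<longleftrightarrow> strict_type_4 \<Omega> p0"
proof -
  define \<Psi> where "\<Psi> = inv_into U' \<Phi>"
  have \<Phi>: "open U'" "open U" "bij_betw \<Phi> U' U" "holomorphic_map_on \<Phi> U'" "holomorphic_map_on \<Psi> U"
    using assms(9) unfolding biholomorphic_map_def \<Psi>_def by auto
  interpret biholomorphic_boundary_pair \<Phi> \<Psi> U' U \<Omega>' \<Omega>
  proof
    show "\<Phi> x \<in> U" "\<Psi> (\<Phi> x) = x" if "x \<in> U'" for x
      using \<Phi>(3) that by (auto simp: \<Psi>_def bij_betw_def)
    show "\<Psi> y \<in> U'" "\<Phi> (\<Psi> y) = y" if "y \<in> U" for y
      using \<Phi>(3) that by (auto simp: \<Psi>_def bij_betw_def f_inv_into_f inv_into_into)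
    \<comment> \<open>Injectivity of \<open>\<Phi>\<close> on \<open>U'\<close> turns the equality
      of images into a pointwise equivalence.\<close>
    show "x \<in> \<Omega>' \<longleftrightarrow> \<Phi> x \<in> \<Omega>" if "x \<in> U'" for x
    proof -
      have "\<Phi> x \<in> \<Omega> \<longleftrightarrow> \<Phi> x \<in> \<Phi> ` (\<Omega>' \<inter> U')"
        using \<Phi>(3) that assms(10) by (auto simp: bij_betw_def)
      then show ?thesis
        using inj_on_image_mem_iff[of \<Phi> U' x "\<Omega>' \<inter> U'"] \<Phi>(3) that by (auto simp: bij_betw_def)
    qed
  qed (use \<Phi> in auto)
  show ?thesis
    \<comment> \<open>Pullback along \<open>\<Phi>\<close> gives the implication from right to left;
      pullback along \<open>\<Psi>\<close>, with \<open>\<Psi> p0 = p0'\<close>, gives the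
      other.\<close>
    using strict_type_4_pullback[OF assms(7)] assms(11)
      biholomorphic_boundary_pair.strict_type_4_pullback[OF swap assms(8)] GF[OF assms(7)] by auto
qed

end
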